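(* Let $\Omega\subset\mathbb{R}^N$ ($N\ge2$) be a domain, let $1<p<\infty$, let $\tilde a:\Omega\to\mathbb{R}$ be a $C^1$ function with $\tilde a(x)\ge1$ for all $x\in\Omega$, and let $u:\Omega\to\mathbb{R}$ be continuous. Define $\alpha_p,\beta_p$ by $\alpha_p+\beta_p=1$ and $\frac{\alpha_p}{\beta_p}=\frac{p-2}{N+2}$. Then $u$ is a viscosity solution (in the sense given in the context) of $$-\operatorname{div}\left(\tilde a(x)|\nabla u|^{p-2}\nabla u\right)=0\quad\text{in }\Omega$$ if and only if the asymptotic expansion $$\begin{aligned}u(x)={}&\frac{\alpha_p}{2}\left\{\max_{\overline{B_\varepsilon(x)}}u+\min_{\overline{B_\varepsilon(x)}}u\right\}+\beta_p\,\frac{1}{|B_\varepsilon(x)|}\int_{B_\varepsilon(x)}u(y)\,dy\\&+\frac{\varepsilon}{4(N+p)\tilde a(x)}\,\frac{1}{|B_\varepsilon(x)|}\int_{B_\varepsilon(x)}\big(u(y+\varepsilon\nabla\tilde a(x))-u(y-\varepsilon\nabla\tilde a(x))\big)\,dy+o(\varepsilon^2)\end{aligned}$$ as $\varepsilon\to0$ holds for all $x\in\Omega$ in the viscosity sense (as defined in the context).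
   Context: $B_\varepsilon(x)$ is the open ball of radius $\varepsilon$ centred at $x$, and $|B_\varepsilon(x)|$ its Lebesgue measure. When $\nabla\phi(x)\ne0$, $\Delta_\infty\phi(x)=|\nabla\phi(x)|^{-2}\langle D^2\phi(x)\nabla\phi(x),\nabla\phi(x)\rangle$. **Viscosity solution.** The continuous function $u$ is a viscosity solution if for every $x\in\Omega$: for every $C^2$ function $\phi$ such that $u-\phi$ has a strict minimum at $x$ and $\nabla\phi(x)\ne0$, $$-\tilde a(x)\big((p-2)\Delta_\infty\phi(x)+\Delta\phi(x)\big)-\langle\nabla\tilde a(x),\nabla\phi(x)\rangle\ge0,$$ and for every $C^2$ function $\phi$ such that $u-\phi$ has a strict maximum at $x$ and $\nabla\phi(x)\neq0$, the same expression is $\le0$. **Asymptotic expansion in the viscosity sense.** For a $C^2$ function $\phi$, let $E_\varepsilon[\phi](x)$ be $-\phi(x)$ plus the right-hand side of the expansion (without $o(\varepsilon^2)$) with $u$ replaced by $\phi$. The expansion holds at $x$ in the viscosity sense if: (i) for every $C^2$ function $\phi$ such that $u-\phi$ has a strict minimum at $x$ with $u(x)=\phi(x)$ and $\nabla\phi(x)\ne0$, $0\ge E_\varepsilon[\phi](x)+o(\varepsilon^2)$ as $\varepsilon\to0$; (ii) for every $C^2$ function $\phi$ such that $u-\phi$ has a strict maximum at $x$ with $u(x)=\phi(x)$ and $\nabla\phi(x)\ne0$, $0\le E_\varepsilon[\phi](x)+o(\varepsilon^2)$ as $\varepsilon\to0$. Here $0\ge E_\varepsilon+o(\varepsilon^2)$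 means that there is $r(\varepsilon)$ with $r(\varepsilon)/\varepsilon^2\to0$ as $\varepsilon\to0^+$ and $E_\varepsilon+r(\varepsilon)\le0$ for all sufficiently small $\varepsilon>0$; similarly for $\le$. *)

theory Defs
  imports "HOL-Analysis.Analysis"
begin

definition grad :: "(real ^ 'n \<Rightarrow> real) \<Rightarrow> real ^ 'n \<Rightarrow> real ^ 'n" where
  "grad f x = (\<chi> i. frechet_derivative f (at x) (axis i 1))"

lemma gderiv_grad:
  fixes f :: "real ^ 'n \<Rightarrow> real"
  assumes "f differentiable (at x)"
  shows "GDERIV f x :> grad f x"
proof -
  let ?D = "frechet_derivative f (at x)"
  have D: "(f has_derivative ?D) (at x)"
    using assms frechet_derivative_works by blast
  then have lin: "linear ?D"
    by (rule has_derivative_linear)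
  have "?D = (\<lambda>h. h \<bullet> grad f x)"
  proof
    fix h :: "real ^ 'n"
    have "?D h = ?D (\<Sum>i\<in>UNIV. h $ i *\<^sub>R axis i 1)"
      using basis_expansion[of h] by (simp add: scalar_mult_eq_scaleR)
    also have "\<dots> = h \<bullet> grad f x"
      by (simp add: linear_sum[OF lin] linear_scale[OF lin] inner_vec_def grad_def)
    finally show "?D h = h \<bullet> grad f x" .
  qed
  with D show ?thesis
    by (simp add: gderiv_def)
qed

definition hessian :: "(real ^ 'n \<Rightarrow> real) \<Rightarrow> real ^ 'n \<Rightarrow> real ^ 'n ^ 'n" where
  "hessian f x = jacobian (grad f) (at x)"

definition laplacian :: "(real ^ 'n \<Rightarrow> real) \<Rightarrow> real ^ 'n \<Rightarrow> real" where
  "laplacian f x = trace (hessian f x)"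

text \<open>The normalized infinity Laplacian, meaningful where the gradient does not vanish.\<close>

definition inf_laplacian :: "(real ^ 'n \<Rightarrow> real) \<Rightarrow> real ^ 'n \<Rightarrow> real" where
  "inf_laplacian f x = ((hessian f x *v grad f x) \<bullet> grad f x) / (norm (grad f x))\<^sup>2"

text \<open>
  Continuous differentiability is meant for open sets \<open>S\<close>; the functions are total, but
  on an open set none of the conditions depends on their values outside \<open>S\<close>.
\<close>

definition C1_on :: "(real ^ 'n) set \<Rightarrow> (real ^ 'n \<Rightarrow> real) \<Rightarrow> bool" where
  "C1_on S f \<longleftrightarrow> (\<forall>x\<in>S. f differentiable (at x)) \<and> continuous_on S (grad f)"

definition C2_on :: "(real ^ 'n) set \<Rightarrow> (real ^ 'n \<Rightarrow> real) \<Rightarrow> bool" where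
  "C2_on S f \<longleftrightarrow>
     C1_on S f \<and> (\<forall>x\<in>S. grad f differentiable (at x)) \<and> continuous_on S (hessian f)"

definition strict_min_at :: "'a set \<Rightarrow> ('a \<Rightarrow> real) \<Rightarrow> 'a \<Rightarrow> bool" where
  "strict_min_at S f x \<longleftrightarrow> x \<in> S \<and> (\<forall>y\<in>S. y \<noteq> x \<longrightarrow> f x < f y)"

definition strict_max_at :: "'a set \<Rightarrow> ('a \<Rightarrow> real) \<Rightarrow> 'a \<Rightarrow> bool" where
  "strict_max_at S f x \<longleftrightarrow> x \<in> S \<and> (\<forall>y\<in>S. y \<noteq> x \<longrightarrow> f y < f x)"

text \<open>
  Where the gradient of \<open>\<phi>\<close> does not vanish,
  \<open>- div (a |\<nabla>\<phi>|\<^sup>p\<^sup>-\<^sup>2 \<nabla>\<phi>)\<close> is \<open>|\<nabla>\<phi>|\<^sup>p\<^sup>-\<^sup>2\<close> times the following expression.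
\<close>

definition weighted_p_operator ::
    "real \<Rightarrow> (real ^ 'n \<Rightarrow> real) \<Rightarrow> (real ^ 'n \<Rightarrow> real) \<Rightarrow> real ^ 'n \<Rightarrow> real" where
  "weighted_p_operator p a \<phi> x =
     - a x * ((p - 2) * inf_laplacian \<phi> x + laplacian \<phi> x) - grad a x \<bullet> grad \<phi> x"

definition viscosity_solution ::
    "(real ^ 'n) set \<Rightarrow> real \<Rightarrow> (real ^ 'n \<Rightarrow> real) \<Rightarrow> (real ^ 'n \<Rightarrow> real) \<Rightarrow> bool" where
  "viscosity_solution \<Omega> p a u \<longleftrightarrow>
     (\<forall>x\<in>\<Omega>.
        (\<forall>\<phi>. C2_on \<Omega> \<phi> \<and> strict_min_at \<Omega> (\<lambda>y. u y - \<phi> y) x \<and> grad \<phi> x \<noteq> 0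
           \<longrightarrow> weighted_p_operator p a \<phi> x \<ge> 0) \<and>
        (\<forall>\<phi>. C2_on \<Omega> \<phi> \<and> strict_max_at \<Omega> (\<lambda>y. u y - \<phi> y) x \<and> grad \<phi> x \<noteq> 0
           \<longrightarrow> weighted_p_operator p a \<phi> x \<le> 0))"

definition ball_mean :: "real ^ 'n \<Rightarrow> real \<Rightarrow> (real ^ 'n \<Rightarrow> real) \<Rightarrow> real" where
  "ball_mean x \<epsilon> f = (LINT y:ball x \<epsilon>|lebesgue. f y) / measure lebesgue (ball x \<epsilon>)"

text \<open>
  The supremum and infimum are the maximum and minimum of the continuous function \<open>\<phi>\<close> on the
  closed ball. Only small \<open>\<epsilon> > 0\<close> matter, for which the closed ball and the shifted balls lie
  in the set on which \<open>\<phi>\<close> is continuous.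
\<close>

definition expansion_error ::
    "real \<Rightarrow> real \<Rightarrow> real \<Rightarrow> (real ^ 'n \<Rightarrow> real) \<Rightarrow> (real ^ 'n \<Rightarrow> real) \<Rightarrow> real ^ 'n \<Rightarrow> real \<Rightarrow> real"
  where
  "expansion_error p \<alpha> \<beta> a \<phi> x \<epsilon> =
     - \<phi> x
     + \<alpha> / 2 * ((SUP y\<in>cball x \<epsilon>. \<phi> y) + (INF y\<in>cball x \<epsilon>. \<phi> y))
     + \<beta> * ball_mean x \<epsilon> \<phi>
     + \<epsilon> / (4 * (real CARD('n) + p) * a x)
         * ball_mean x \<epsilon> (\<lambda>y. \<phi> (y + \<epsilon> *\<^sub>R grad a x) - \<phi> (y - \<epsilon> *\<^sub>R grad a x))"

definition expansion_holds_viscosity ::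
    "(real ^ 'n) set \<Rightarrow> real \<Rightarrow> real \<Rightarrow> real \<Rightarrow> (real ^ 'n \<Rightarrow> real) \<Rightarrow> (real ^ 'n \<Rightarrow> real)
       \<Rightarrow> real ^ 'n \<Rightarrow> bool" where
  "expansion_holds_viscosity \<Omega> p \<alpha> \<beta> a u x \<longleftrightarrow>
     (\<forall>\<phi>. C2_on \<Omega> \<phi> \<and> strict_min_at \<Omega> (\<lambda>y. u y - \<phi> y) x \<and> u x = \<phi> x \<and> grad \<phi> x \<noteq> 0
        \<longrightarrow> (\<exists>r. ((\<lambda>\<epsilon>. r \<epsilon> / \<epsilon>\<^sup>2) \<longlongrightarrow> 0) (at_right 0) \<and>
                 (\<forall>\<^sub>F \<epsilon> in at_right 0. expansion_error p \<alpha> \<beta> a \<phi> x \<epsilon> + r \<epsilon> \<le> 0))) \<and>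
     (\<forall>\<phi>. C2_on \<Omega> \<phi> \<and> strict_max_at \<Omega> (\<lambda>y. u y - \<phi> y) x \<and> u x = \<phi> x \<and> grad \<phi> x \<noteq> 0
        \<longrightarrow> (\<exists>r. ((\<lambda>\<epsilon>. r \<epsilon> / \<epsilon>\<^sup>2) \<longlongrightarrow> 0) (at_right 0) \<and>
                 (\<forall>\<^sub>F \<epsilon> in at_right 0. expansion_error p \<alpha> \<beta> a \<phi> x \<epsilon> + r \<epsilon> \<ge> 0)))"

end

theory Submission
  imports Defs
begin

text \<open>
  Both sides of the equivalence test the same functions \<open>\<phi>\<close>, up to an additive constant, so the
  theorem reduces to a statement about a single \<open>C\<^sup>2\<close> function with \<open>\<nabla>\<phi>(x) \<noteq> 0\<close>: the expansion
  error of \<open>\<phi>\<close> at \<open>x\<close>, divided by \<open>\<epsilon>\<^sup>2\<close>, converges to a negative multiple of the weighted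
  \<open>p\<close>-operator (\<open>expansion_error_limit\<close>). A correction \<open>o(\<epsilon>\<^sup>2)\<close> that gives the error a sign then
  exists exactly if the limit has this sign (\<open>little_o_correction_le_iff\<close>).

  Write \<open>g = \<nabla>\<phi>(x)\<close> and \<open>H = D\<^sup>2\<phi>(x)\<close>. The limit is the sum of three expansions, all consequences
  of Taylor's formula \<open>\<phi>(x + h) = \<phi>(x) + g \<bullet> h + (H h) \<bullet> h / 2 + o(|h|\<^sup>2)\<close>:

  \<^item> Maximum and minimum over the ball are \<open>\<phi>(x) \<plusminus> \<epsilon> |g| + \<epsilon>\<^sup>2/2 \<Delta>\<^sub>\<infinity>\<phi>(x) + o(\<epsilon>\<^sup>2)\<close>: since
    \<open>g \<noteq> 0\<close>, nearly extremal points are close to \<open>x \<plusminus> \<epsilon> g/|g|\<close>. The linear terms cancel in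
    the sum.
  \<^item> The mean over the ball is \<open>\<phi>(x) + \<epsilon>\<^sup>2 \<Delta>\<phi>(x) / (2 (N + 2)) + o(\<epsilon>\<^sup>2)\<close>: by the symmetries of the
    ball only the squares of the coordinates contribute, and all of them equally.
  \<^item> The mean of \<open>\<phi>(y + \<epsilon> v) - \<phi>(y - \<epsilon> v)\<close> is \<open>2 \<epsilon> v \<bullet> g + o(\<epsilon>)\<close>, by differentiability alone;
    with \<open>v = \<nabla>a(x)\<close> this is the drift term.

  The conditions on \<open>\<alpha>\<close> and \<open>\<beta>\<close> say that \<open>\<alpha> = (p - 2)/(N + p)\<close> and \<open>\<beta> = (N + 2)/(N + p)\<close>, and with
  these weights the three contributions combine to the weighted operator. The expansions are
  equalities up to \<open>o(\<epsilon>\<^sup>2)\<close>, so they may be multiplied by \<open>\<alpha>\<close> also for \<open>p < 2\<close>, where \<open>\<alpha> < 0\<close>.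
\<close>

section \<open>Second-order Taylor expansion\<close>

text \<open>
  This is Taylor's formula with the Peano remainder, with the two coefficients as parameters,
  so that it passes from \<open>f\<close> to \<open>- f\<close> and maxima can be exchanged for minima.
\<close>

definition second_order_jet ::
    "(real ^ 'n \<Rightarrow> real) \<Rightarrow> real ^ 'n \<Rightarrow> real ^ 'n \<Rightarrow> real ^ 'n ^ 'n \<Rightarrow> bool" where
  "second_order_jet f x g H \<longleftrightarrow>
     (\<forall>e>0. \<exists>d>0. \<forall>h. norm h < d \<longrightarrow>
        \<bar>f (x + h) - (f x + g \<bullet> h + (H *v h) \<bullet> h / 2)\<bar> \<le> e * (norm h)\<^sup>2)"

lemma second_order_jet_uminus:
  assumes "second_order_jet f x g H"
  shows "second_order_jet (\<lambda>y. - f y) x (- g) (- H)"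
  unfolding second_order_jet_def
proof (intro allI impI)
  fix e :: real assume "e > 0"
  with assms obtain d where "d > 0"
    and d: "\<And>h. norm h < d \<Longrightarrow>
      \<bar>f (x + h) - (f x + g \<bullet> h + (H *v h) \<bullet> h / 2)\<bar> \<le> e * (norm h)\<^sup>2"
    unfolding second_order_jet_def by blast
  have "\<bar>- f (x + h) - (- f x + (- g) \<bullet> h + ((- H) *v h) \<bullet> h / 2)\<bar>
        = \<bar>f (x + h) - (f x + g \<bullet> h + (H *v h) \<bullet> h / 2)\<bar>" for h
  proof -
    have "(- H) *v h = - (H *v h)"
      by (simp add: matrix_vector_mult_def vec_eq_iff sum_negf)
    then show ?thesis by simp
  qed
  with \<open>d > 0\<close> d show "\<exists>d>0. \<forall>h. norm h < d \<longrightarrow>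
      \<bar>- f (x + h) - (- f x + (- g) \<bullet> h + ((- H) *v h) \<bullet> h / 2)\<bar> \<le> e * (norm h)\<^sup>2"
    by metis
qed

text \<open>
  The mean value theorem is applied on the segment from \<open>x\<close> to \<open>x + h\<close> to the difference
  between \<open>f\<close> and its Taylor polynomial. Its derivative along the segment is the first-order
  remainder of the gradient, which is \<open>o(|h|)\<close> by differentiability at \<open>x\<close>, times \<open>h\<close>.
\<close>

lemma second_order_jet_grad_hessian:
  fixes f :: "real ^ 'n \<Rightarrow> real"
  assumes "open S" and "x \<in> S"
    and diff: "\<And>y. y \<in> S \<Longrightarrow> f differentiable (at y)"
    and "grad f differentiable (at x)"
  shows "second_order_jet f x (grad f x) (hessian f x)"
  unfolding second_order_jet_def
proof (intro allI impI)
  fix e :: real assume "e > 0"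
  let ?g = "grad f x" and ?H = "hessian f x"
  have "(grad f has_derivative (\<lambda>h. ?H *v h)) (at x)"
    using assms(4) unfolding hessian_def by (simp add: jacobian_works)
  with \<open>e > 0\<close> obtain d1 where "d1 > 0" and d1: "\<And>y. norm (y - x) < d1 \<Longrightarrow>
      norm (grad f y - ?g - ?H *v (y - x)) \<le> e * norm (y - x)"
    unfolding has_derivative_at_alt by blast
  obtain d2 where "d2 > 0" and d2: "ball x d2 \<subseteq> S"
    using assms(1,2) openE by blast
  have "\<bar>f (x + h) - (f x + ?g \<bullet> h + (?H *v h) \<bullet> h / 2)\<bar> \<le> e * (norm h)\<^sup>2"
    if h: "norm h < min d1 d2" for h
  proof -
    \<comment> \<open>The remainder along the segment, up to the constant \<open>f x\<close>, and its derivative.\<close>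
    define \<psi> where "\<psi> t = f (x + t *\<^sub>R h) - t * (?g \<bullet> h) - t\<^sup>2 / 2 * ((?H *v h) \<bullet> h)" for t
    define \<psi>' where
      "\<psi>' t = grad f (x + t *\<^sub>R h) \<bullet> h - ?g \<bullet> h - t * ((?H *v h) \<bullet> h)" for t
    have near: "norm (t *\<^sub>R h) < min d1 d2" if "0 \<le> t" "t \<le> 1" for t
      using that h by (auto intro: le_less_trans[OF mult_left_le_one_le])
    have deriv: "(\<psi> has_real_derivative \<psi>' t) (at t)" if t: "0 \<le> t" "t \<le> 1" for t
    proof -
      have "x + t *\<^sub>R h \<in> S"
        using near[OF t] d2 by (auto simp: dist_norm)
      then have "(f has_derivative (\<lambda>k. k \<bullet> grad f (x + t *\<^sub>R h))) (at (x + t *\<^sub>R h))"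
        using gderiv_grad[OF diff] unfolding gderiv_def by blast
      moreover have "((\<lambda>t. x + t *\<^sub>R h) has_derivative (\<lambda>s. s *\<^sub>R h)) (at t)"
        by (auto intro!: derivative_eq_intros)
      ultimately have "((\<lambda>t. f (x + t *\<^sub>R h)) has_derivative
          (\<lambda>s. (s *\<^sub>R h) \<bullet> grad f (x + t *\<^sub>R h))) (at t)"
        using has_derivative_compose[of "\<lambda>t. x + t *\<^sub>R h"] by blast
      then have "((\<lambda>t. f (x + t *\<^sub>R h)) has_real_derivative grad f (x + t *\<^sub>R h) \<bullet> h) (at t)"
        by (simp add: has_field_derivative_def inner_commute mult.commute[of _ "inner _ _"])
      then show ?thesis
        unfolding \<psi>_def \<psi>'_def by (auto intro!: derivative_eq_intros)
    qed
    have "\<exists>z>0. z < 1 \<and> \<psi> 1 - \<psi> 0 = (1 - 0) * \<psi>' z"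
      by (rule MVT2) (use deriv in auto)
    then obtain z where z: "0 < z" "z < 1" "\<psi> 1 - \<psi> 0 = \<psi>' z"
      by auto
    have "\<psi>' z = (grad f (x + z *\<^sub>R h) - ?g - ?H *v (z *\<^sub>R h)) \<bullet> h"
      by (simp add: \<psi>'_def inner_diff_left matrix_vector_mult_scaleR)
    also have "\<bar>\<dots>\<bar> \<le> norm (grad f (x + z *\<^sub>R h) - ?g - ?H *v (z *\<^sub>R h)) * norm h"
      by (rule Cauchy_Schwarz_ineq2)
    also have "\<dots> \<le> (e * norm (z *\<^sub>R h)) * norm h"
      using d1[of "x + z *\<^sub>R h"] near[of z] z by (intro mult_right_mono) auto
    also have "\<dots> \<le> (e * norm h) * norm h"
      using z \<open>e > 0\<close> by (intro mult_right_mono mult_left_mono) (auto intro: mult_left_le_one_le)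
    finally have "\<bar>\<psi> 1 - \<psi> 0\<bar> \<le> e * (norm h)\<^sup>2"
      using z by (simp add: power2_eq_square mult.assoc)
    then show ?thesis
      by (simp add: \<psi>_def algebra_simps)
  qed
  moreover have "min d1 d2 > 0"
    using \<open>d1 > 0\<close> \<open>d2 > 0\<close> by simp
  ultimately show "\<exists>d>0. \<forall>h. norm h < d \<longrightarrow>
      \<bar>f (x + h) - (f x + ?g \<bullet> h + (?H *v h) \<bullet> h / 2)\<bar> \<le> e * (norm h)\<^sup>2"
    by blast
qed

section \<open>Extrema over small balls\<close>

text \<open>
  On the ball of radius \<open>r\<close> the linear part is largest at \<open>m = r n\<close>, where \<open>n = g/|g|\<close>. Moving away
  from \<open>m\<close> by a distance \<open>s\<close> lowers the linear part by at least \<open>|g| s\<^sup>2 / (2 r)\<close>, by the roundness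
  of the sphere, while the quadratic part gains at most \<open>B r s\<close>. The balance of the two is of
  order \<open>r\<^sup>3\<close>.
\<close>

lemma quadratic_le_on_ball:
  fixes H :: "real ^ 'n ^ 'n"
  assumes "g \<noteq> 0" and h: "norm h \<le> r" and "0 < r"
    and B: "\<And>w. norm (H *v w) \<le> B * norm w" and "0 \<le> B"
  defines "n \<equiv> g /\<^sub>R norm g"
  shows "g \<bullet> h + (H *v h) \<bullet> h / 2
    \<le> r * norm g + r\<^sup>2 * ((H *v n) \<bullet> n) / 2 + B\<^sup>2 / (2 * norm g) * r ^ 3"
proof -
  define m where "m = r *\<^sub>R n"
  define s where "s = norm (h - m)"
  have n: "norm n = 1" and g: "g = norm g *\<^sub>R n"
    using \<open>g \<noteq> 0\<close> by (simp_all add: n_def)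
  have m: "norm m = r"
    using n \<open>0 < r\<close> by (simp add: m_def)
  have "s\<^sup>2 = (norm h)\<^sup>2 - 2 * (h \<bullet> m) + (norm m)\<^sup>2"
    unfolding s_def power2_norm_eq_inner by (simp add: inner_diff inner_commute)
  also have "\<dots> \<le> 2 * r * (r - n \<bullet> h)"
    using m power_mono[OF h norm_ge_zero, of 2]
    by (simp add: m_def inner_commute power2_eq_square algebra_simps)
  finally have "n \<bullet> h \<le> r - s\<^sup>2 / (2 * r)"
    using \<open>0 < r\<close> by (simp add: field_simps)
  then have "norm g * (n \<bullet> h) \<le> norm g * (r - s\<^sup>2 / (2 * r))"
    by (intro mult_left_mono) auto
  then have linear: "g \<bullet> h \<le> r * norm g - norm g * s\<^sup>2 / (2 * r)"
    by (subst g) (simp add: algebra_simps)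
  have "(H *v h) \<bullet> h - (H *v m) \<bullet> m = (H *v (h - m)) \<bullet> h + (H *v m) \<bullet> (h - m)"
    by (simp add: matrix_vector_mult_diff_distrib inner_diff)
  also have "\<dots> \<le> norm (H *v (h - m)) * norm h + norm (H *v m) * norm (h - m)"
    by (intro add_mono norm_cauchy_schwarz)
  also have "\<dots> \<le> (B * s) * r + (B * r) * s"
    unfolding s_def using B[of "h - m"] B[of m] h m \<open>0 \<le> B\<close> by (intro add_mono mult_mono) auto
  finally have "(H *v h) \<bullet> h \<le> (H *v m) \<bullet> m + 2 * B * r * s"
    by simp
  moreover have "(H *v m) \<bullet> m = r\<^sup>2 * ((H *v n) \<bullet> n)"
    by (simp add: m_def matrix_vector_mult_scaleR power2_eq_square)
  ultimately have quadratic: "(H *v h) \<bullet> h / 2 \<le> r\<^sup>2 * ((H *v n) \<bullet> n) / 2 + B * r * s"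
    by simp
  \<comment> \<open>Completing the square in \<open>s\<close> bounds the net gain \<open>B r s - |g| s\<^sup>2 / (2 r)\<close>.\<close>
  have "0 \<le> norm g / (2 * r) * (s - B * r\<^sup>2 / norm g)\<^sup>2"
    using \<open>0 < r\<close> by simp
  also have "\<dots> = norm g * s\<^sup>2 / (2 * r) - B * r * s + B\<^sup>2 / (2 * norm g) * r ^ 3"
    using \<open>0 < r\<close> \<open>g \<noteq> 0\<close> by (simp add: field_simps power2_eq_square power3_eq_cube)
  finally show ?thesis
    using linear quadratic by linarith
qed

text \<open>
  The upper bound is \<open>quadratic_le_on_ball\<close>; the lower bound comes from the value at
  \<open>x + r g/|g|\<close>. The limit is half the normalized infinity Laplacian if \<open>g\<close> and \<open>H\<close> are the
  gradient and the Hessian of \<open>f\<close>.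
\<close>

lemma cSUP_cball_expansion:
  fixes f :: "real ^ 'n \<Rightarrow> real"
  assumes jet: "second_order_jet f x g H" and "g \<noteq> 0"
  shows "((\<lambda>r. ((SUP y\<in>cball x r. f y) - f x - r * norm g) / r\<^sup>2)
    \<longlongrightarrow> ((H *v g) \<bullet> g) / (norm g)\<^sup>2 / 2) (at_right 0)"
proof (rule tendstoI)
  fix e :: real assume "e > 0"
  define n where "n = g /\<^sub>R norm g"
  have n: "norm n = 1" "g \<bullet> n = norm g"
    using \<open>g \<noteq> 0\<close> by (simp_all add: n_def power2_norm_eq_inner[symmetric] power2_eq_square)
  have k: "((H *v g) \<bullet> g) / (norm g)\<^sup>2 = (H *v n) \<bullet> n"
    by (simp add: n_def matrix_vector_mult_scaleR divide_inverse power2_eq_square)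
  obtain B where "B > 0" and B: "\<And>w. norm (H *v w) \<le> B * norm w"
    using bounded_linear.pos_bounded[OF matrix_vector_mul_bounded_linear[of H]]
    by (metis mult.commute)
  define C where "C = B\<^sup>2 / (2 * norm g)"
  obtain d where "d > 0" and d: "\<And>h. norm h < d \<Longrightarrow>
      \<bar>f (x + h) - (f x + g \<bullet> h + (H *v h) \<bullet> h / 2)\<bar> \<le> e / 3 * (norm h)\<^sup>2"
    using jet \<open>e > 0\<close> unfolding second_order_jet_def by (metis zero_less_divide_iff zero_less_numeral)
  have "((\<lambda>r. C * r) \<longlongrightarrow> C * 0) (at_right 0)"
    by (intro tendsto_intros)
  then have "eventually (\<lambda>r. C * r < e / 3) (at_right 0)"
    using \<open>e > 0\<close> by (intro order_tendstoD(2)) auto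
  moreover have "eventually (\<lambda>r. r < d) (at_right (0::real))"
    using \<open>d > 0\<close> by (intro eventually_at_rightI[of 0 d]) auto
  ultimately show "eventually (\<lambda>r. dist (((SUP y\<in>cball x r. f y) - f x - r * norm g) / r\<^sup>2)
      (((H *v g) \<bullet> g) / (norm g)\<^sup>2 / 2) < e) (at_right 0)"
    using eventually_at_right_less[of 0]
  proof eventually_elim
    case (elim r)
    let ?Q = "f x + r * norm g + r\<^sup>2 * ((H *v n) \<bullet> n) / 2"
    have upper: "f y \<le> ?Q + C * r ^ 3 + e / 3 * r\<^sup>2" if "y \<in> cball x r" for y
    proof -
      define h where "h = y - x"
      have h: "norm h \<le> r" and y: "y = x + h"
        using that by (auto simp: h_def dist_norm norm_minus_commute)
      have "f y \<le> f x + (g \<bullet> h + (H *v h) \<bullet> h / 2) + e / 3 * (norm h)\<^sup>2"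
        using abs_le_D1[OF d[of h]] h elim unfolding y by linarith
      also have "\<dots> \<le> f x + (r * norm g + r\<^sup>2 * ((H *v n) \<bullet> n) / 2 + C * r ^ 3) + e / 3 * r\<^sup>2"
        unfolding C_def n_def
        using h \<open>e > 0\<close> \<open>B > 0\<close> elim \<open>g \<noteq> 0\<close>
        by (intro add_mono order_refl mult_left_mono power_mono quadratic_le_on_ball B) auto
      finally show ?thesis by simp
    qed
    have "(SUP y\<in>cball x r. f y) \<le> ?Q + C * r ^ 3 + e / 3 * r\<^sup>2"
      using elim by (intro cSUP_least upper) auto
    then have "(SUP y\<in>cball x r. f y) - ?Q \<le> (C * r + e / 3) * r\<^sup>2"
      by (simp add: algebra_simps power2_eq_square power3_eq_cube)
    also have "\<dots> < (e / 3 + e / 3) * r\<^sup>2"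
      using elim by (intro mult_strict_right_mono) auto
    finally have 1: "(SUP y\<in>cball x r. f y) - ?Q < 2 / 3 * e * r\<^sup>2"
      by simp
    have "?Q - e / 3 * r\<^sup>2 \<le> f (x + r *\<^sub>R n)"
      using abs_le_D2[OF d[of "r *\<^sub>R n"]] elim n
      by (simp add: matrix_vector_mult_scaleR power2_eq_square algebra_simps)
    also have "\<dots> \<le> (SUP y\<in>cball x r. f y)"
      using upper elim n by (intro cSUP_upper) (auto simp: dist_norm intro!: bdd_aboveI2)
    finally have 2: "?Q - e / 3 * r\<^sup>2 \<le> (SUP y\<in>cball x r. f y)" .
    have "e * r\<^sup>2 > 0"
      using \<open>e > 0\<close> elim by simp
    then have abs: "\<bar>(SUP y\<in>cball x r. f y) - ?Q\<bar> < e * r\<^sup>2"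
      using 1 2 by (simp add: abs_less_iff)
    have eq: "((SUP y\<in>cball x r. f y) - f x - r * norm g) / r\<^sup>2
        - ((H *v g) \<bullet> g) / (norm g)\<^sup>2 / 2 = ((SUP y\<in>cball x r. f y) - ?Q) / r\<^sup>2"
      unfolding k using elim by (simp add: field_simps)
    show ?case
      unfolding dist_real_def eq using elim abs by (simp add: abs_divide pos_divide_less_eq)
  qed
qed

lemma cINF_cball_expansion:
  fixes f :: "real ^ 'n \<Rightarrow> real"
  assumes "second_order_jet f x g H" and "g \<noteq> 0"
  shows "((\<lambda>r. ((INF y\<in>cball x r. f y) - f x + r * norm g) / r\<^sup>2)
    \<longlongrightarrow> ((H *v g) \<bullet> g) / (norm g)\<^sup>2 / 2) (at_right 0)"
proof -
  have neg: "(- H) *v (- g) = H *v g"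
    by (simp add: matrix_vector_mult_def vec_eq_iff)
  have inf: "(INF y\<in>cball x r. f y) = - (SUP y\<in>cball x r. - f y)" for r
    by (simp add: Inf_real_def image_image)
  have "((\<lambda>r. - (((SUP y\<in>cball x r. - f y) - (- f x) - r * norm (- g)) / r\<^sup>2))
      \<longlongrightarrow> - ((((- H) *v (- g)) \<bullet> (- g)) / (norm (- g))\<^sup>2 / 2)) (at_right 0)"
    by (intro tendsto_minus cSUP_cball_expansion second_order_jet_uminus assms) (use assms in auto)
  then show ?thesis
    by (simp add: neg inf diff_divide_distrib add_divide_distrib algebra_simps)
qed

section \<open>Means over balls\<close>

lemma set_integrable_ball_continuous:
  fixes f :: "real ^ 'n \<Rightarrow> real"
  assumes "continuous_on (cball x r) f"
  shows "set_integrable lebesgue (ball x r) f"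
proof -
  have "set_integrable lborel (cball x r) f"
    unfolding set_integrable_def by (intro borel_integrable_compact assms compact_cball)
  then have "set_integrable lebesgue (cball x r) f"
    unfolding set_integrable_def by (simp add: integrable_completion borel_measurable_integrable)
  then show ?thesis
    by (rule set_integrable_subset) (auto simp: ball_subset_cball)
qed

lemma ball_mean_lborel:
  fixes f :: "real ^ 'n \<Rightarrow> real"
  assumes "continuous_on (cball x r) f"
  shows "ball_mean x r f
    = (\<integral>y. indicator (ball x r) y *\<^sub>R f y \<partial>lborel) / measure lborel (ball x r)"
proof -
  have "continuous_on (ball x r) f"
    using assms by (rule continuous_on_subset) auto
  then have "(\<lambda>y. indicator (ball x r) y *\<^sub>R f y) \<in> borel_measurable lborel"
    using borel_measurable_continuous_on_indicator[of "ball x r" f] by simp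
  then show ?thesis
    unfolding ball_mean_def set_lebesgue_integral_def
    by (simp add: integral_completion)
qed

lemma ball_mean_add:
  fixes f h :: "real ^ 'n \<Rightarrow> real"
  assumes "continuous_on (cball x r) f" and "continuous_on (cball x r) h"
  shows "ball_mean x r (\<lambda>y. f y + h y) = ball_mean x r f + ball_mean x r h"
  using assms[THEN set_integrable_ball_continuous]
  by (simp add: ball_mean_def set_integral_add add_divide_distrib)

lemma ball_mean_diff:
  fixes f h :: "real ^ 'n \<Rightarrow> real"
  assumes "continuous_on (cball x r) f" and "continuous_on (cball x r) h"
  shows "ball_mean x r (\<lambda>y. f y - h y) = ball_mean x r f - ball_mean x r h"
  using assms[THEN set_integrable_ball_continuous]
  by (simp add: ball_mean_def set_integral_diff diff_divide_distrib)

lemma ball_mean_mult_left: "ball_mean x r (\<lambda>y. c * f y) = c * ball_mean x r f"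
  by (simp add: ball_mean_def)

lemma ball_mean_const:
  assumes "0 < r"
  shows "ball_mean x r (\<lambda>y. c) = c"
proof -
  have "(LINT y:ball x r|lebesgue. c) = c * measure lborel (ball x r)"
    by (simp add: set_lebesgue_integral_def mult.commute)
  then show ?thesis
    using content_ball_pos[OF assms, of x] by (simp add: ball_mean_def)
qed

lemma ball_mean_sum:
  fixes f :: "'b \<Rightarrow> real ^ 'n \<Rightarrow> real"
  assumes "finite I" and "\<And>i. i \<in> I \<Longrightarrow> continuous_on (cball x r) (f i)"
  shows "ball_mean x r (\<lambda>y. \<Sum>i\<in>I. f i y) = (\<Sum>i\<in>I. ball_mean x r (f i))"
  using assms
proof (induction I rule: finite_induct)
  case empty
  then show ?case by (simp add: ball_mean_def set_lebesgue_integral_def)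
next
  case (insert i I)
  then show ?case by (simp add: ball_mean_add continuous_on_sum)
qed

lemma ball_mean_mono:
  fixes f h :: "real ^ 'n \<Rightarrow> real"
  assumes "continuous_on (cball x r) f" and "continuous_on (cball x r) h"
    and "\<And>y. y \<in> ball x r \<Longrightarrow> f y \<le> h y"
  shows "ball_mean x r f \<le> ball_mean x r h"
  unfolding ball_mean_def
  by (intro divide_right_mono set_integral_mono set_integrable_ball_continuous assms) auto

lemma abs_ball_mean_diff_le:
  fixes f h :: "real ^ 'n \<Rightarrow> real"
  assumes "0 < r" and cont: "continuous_on (cball x r) f" "continuous_on (cball x r) h"
    and le: "\<And>y. y \<in> ball x r \<Longrightarrow> \<bar>f y - h y\<bar> \<le> c"
  shows "\<bar>ball_mean x r f - ball_mean x r h\<bar> \<le> c"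
proof -
  have "ball_mean x r (\<lambda>y. f y - h y) \<le> ball_mean x r (\<lambda>y. c)"
    using le by (intro ball_mean_mono continuous_intros cont) (auto simp: abs_le_iff)
  moreover have "ball_mean x r (\<lambda>y. - c) \<le> ball_mean x r (\<lambda>y. f y - h y)"
    using le by (intro ball_mean_mono continuous_intros cont) (fastforce simp: abs_le_iff)
  ultimately show ?thesis
    using \<open>0 < r\<close> cont by (simp add: ball_mean_const ball_mean_diff abs_le_iff)
qed

lemma ball_mean_rescale:
  fixes f :: "real ^ 'n \<Rightarrow> real"
  assumes "0 < r" and cont: "continuous_on (cball x r) f"
  shows "ball_mean x r f = ball_mean 0 1 (\<lambda>h. f (x + r *\<^sub>R h))"
proof -
  define F where "F y = indicator (ball x r) y *\<^sub>R f y" for y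
  have "continuous_on (ball x r) f"
    using cont by (rule continuous_on_subset) auto
  then have [measurable]: "F \<in> borel_measurable borel"
    unfolding F_def by (intro borel_measurable_continuous_on_indicator) auto
  have "(\<integral>y. F y \<partial>lborel) = r ^ CARD('n) * (\<integral>h. F (x + r *\<^sub>R h) \<partial>lborel)"
    using \<open>0 < r\<close>
    by (subst lborel_affine[of r x]) (simp_all add: integral_density integral_distr)
  also have "(\<lambda>h. F (x + r *\<^sub>R h)) = (\<lambda>h. indicator (ball 0 1) h *\<^sub>R f (x + r *\<^sub>R h))"
    using \<open>0 < r\<close> by (auto simp: F_def fun_eq_iff indicator_def dist_norm)
  finally have "(\<integral>y. F y \<partial>lborel)
      = r ^ CARD('n) * (\<integral>h. indicator (ball 0 1) h *\<^sub>R f (x + r *\<^sub>R h) \<partial>lborel)" .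
  moreover have "continuous_on (cball 0 1) (\<lambda>h. f (x + r *\<^sub>R h))"
    using \<open>0 < r\<close>
    by (intro continuous_on_compose2[OF cont] continuous_intros) (auto simp: dist_norm mult_left_le)
  ultimately show ?thesis
    using \<open>0 < r\<close> cont content_ball_conv_unit_ball[of r x]
    by (simp add: ball_mean_lborel F_def)
qed

text \<open>
  The ball is invariant under every norm-preserving \<open>T\<close>, so a mean over it is invariant as soon
  as \<open>T\<close> preserves Lebesgue measure. The instances below are reflections in a coordinate
  hyperplane and permutations of the coordinates.
\<close>

lemma ball_mean_isometry:
  fixes f :: "real ^ 'n \<Rightarrow> real" and T :: "real ^ 'n \<Rightarrow> real ^ 'n"
  assumes [measurable]: "T \<in> borel \<rightarrow>\<^sub>M borel" and "lborel = distr lborel borel T"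
    and norm: "\<And>h. norm (T h) = norm h"
    and cont: "continuous_on (cball 0 r) f" "continuous_on (cball 0 r) (\<lambda>h. f (T h))"
  shows "ball_mean 0 r (\<lambda>h. f (T h)) = ball_mean 0 r f"
proof -
  define F where "F y = indicator (ball 0 r) y *\<^sub>R f y" for y
  have "continuous_on (ball 0 r) f"
    using cont(1) by (rule continuous_on_subset) auto
  then have [measurable]: "F \<in> borel_measurable borel"
    unfolding F_def by (intro borel_measurable_continuous_on_indicator) auto
  have "(\<integral>y. F y \<partial>lborel) = (\<integral>y. F y \<partial>distr lborel borel T)"
    using assms(2) by simp
  also have "\<dots> = (\<integral>h. F (T h) \<partial>lborel)"
    by (simp add: integral_distr)
  also have "(\<lambda>h. F (T h)) = (\<lambda>h. indicator (ball 0 r) h *\<^sub>R f (T h))"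
    by (simp add: F_def fun_eq_iff indicator_def norm)
  finally show ?thesis
    using cont by (simp add: ball_mean_lborel F_def)
qed

lemma lborel_distr_reflect_coord:
  fixes i :: "'n::finite"
  shows "lborel = distr lborel borel (\<lambda>h :: real ^ 'n. \<chi> k. if k = i then - h $ k else h $ k)"
proof -
  \<comment> \<open>The reflection scales the basis vectors by \<open>-1\<close> and \<open>1\<close>, so its Jacobian is \<open>1\<close> in modulus.\<close>
  let ?c = "\<lambda>b :: real ^ 'n. if b = axis i 1 then - 1 else 1 :: real"
  have "(\<lambda>h. 0 + (\<Sum>b\<in>Basis. (?c b * (h \<bullet> b)) *\<^sub>R b)) = (\<lambda>h. \<chi> k. if k = i then - h $ k else h $ k)"
    (is "?S = ?R")
  proof
    fix h :: "real ^ 'n"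
    have "?S h \<bullet> b = ?R h \<bullet> b" if b: "b \<in> Basis" for b
    proof -
      obtain k where "b = axis k 1" using b by (auto simp: Basis_vec_def)
      have "?S h \<bullet> b = ?c b * (h \<bullet> b)"
        using b by (simp del: inner_axis)
      then show ?thesis
        using \<open>b = axis k 1\<close> by (simp add: inner_axis axis_eq_axis)
    qed
    then show "?S h = ?R h" by (rule euclidean_eqI)
  qed
  moreover have "(\<Prod>b\<in>Basis. \<bar>?c b\<bar>) = 1"
    by (intro prod.neutral) auto
  ultimately show ?thesis
    using lborel_affine_euclidean[of ?c 0] by (simp add: density_1)
qed

text \<open>
  It suffices to compare the measures of boxes. The preimage of a box is the box with permuted
  sides, and both have the same product of side lengths.
\<close>

lemma lborel_distr_permute_coords:
  fixes \<pi> :: "'n::finite \<Rightarrow> 'n"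
  assumes "bij \<pi>"
  shows "lborel = distr lborel borel (\<lambda>h :: real ^ 'n. \<chi> k. h $ \<pi> k)"
proof (rule lborel_eqI)
  let ?T = "\<lambda>h :: real ^ 'n. \<chi> k. h $ \<pi> k"
  let ?T' = "\<lambda>h :: real ^ 'n. \<chi> k. h $ inv \<pi> k"
  fix l u :: "real ^ 'n" assume le: "\<And>b. b \<in> Basis \<Longrightarrow> l \<bullet> b \<le> u \<bullet> b"
  have le': "l $ k \<le> u $ k" for k
    using le[of "axis k 1"] by (simp add: inner_axis)
  have inv: "\<pi> (inv \<pi> k) = k" "inv \<pi> (\<pi> k) = k" for k
    using assms by (simp_all add: bij_is_surj surj_f_inv_f bij_is_inj)
  have [measurable]: "?T \<in> borel \<rightarrow>\<^sub>M borel"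
    by (intro borel_measurable_continuous_onI continuous_intros)
  have "?T -` box l u = box (?T' l) (?T' u)"
    by (auto simp: mem_box_cart) (metis inv)+
  then have "emeasure (distr lborel borel ?T) (box l u) = emeasure lborel (box (?T' l) (?T' u))"
    by (simp add: emeasure_distr)
  also have "\<dots> = ennreal (\<Prod>b\<in>Basis. (?T' u - ?T' l) \<bullet> b)"
    by (subst emeasure_lborel_box) (auto simp: Basis_vec_def inner_axis le')
  also have "(\<Prod>b\<in>Basis. (?T' u - ?T' l) \<bullet> b) = (\<Prod>b\<in>Basis. (u - l) \<bullet> b)"
  proof -
    have *: "(\<Prod>b\<in>Basis. v \<bullet> b) = (\<Prod>k\<in>UNIV. v $ k)" for v :: "real ^ 'n"
    proof -
      have "bij_betw (\<lambda>k. axis k 1) UNIV (Basis :: (real ^ 'n) set)"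
        by (auto simp: bij_betw_def Basis_vec_def inj_on_def axis_eq_axis)
      from prod.reindex_bij_betw[OF this, of "\<lambda>b. v \<bullet> b"] show ?thesis
        by (simp add: inner_axis)
    qed
    have "(\<Prod>k\<in>UNIV. (u - l) $ inv \<pi> k) = (\<Prod>k\<in>UNIV. (u - l) $ k)"
      by (rule prod.reindex_bij_betw) (simp add: assms bij_imp_bij_inv)
    then show ?thesis by (simp add: *)
  qed
  finally show "emeasure (distr lborel borel ?T) (box l u) = ennreal (\<Prod>b\<in>Basis. (u - l) \<bullet> b)" .
qed simp

section \<open>Moments of the unit ball\<close>

lemma ball_mean_coord_odd:
  fixes i :: "'n::finite" and f :: "real ^ 'n \<Rightarrow> real"
  assumes "continuous_on UNIV f"
    and odd: "\<And>h. f (\<chi> k. if k = i then - h $ k else h $ k) = - f h"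
  shows "ball_mean 0 r f = 0"
proof -
  let ?T = "\<lambda>h :: real ^ 'n. \<chi> k. if k = i then - h $ k else h $ k"
  have comp: "continuous_on UNIV (\<lambda>h :: real ^ 'n. if k = i then - h $ k else h $ k)" for k
    by (cases "k = i") (auto intro!: continuous_intros)
  have cont: "continuous_on UNIV ?T"
    by (intro continuous_intros comp)
  have "ball_mean 0 r (\<lambda>h. f (?T h)) = ball_mean 0 r f"
  proof (rule ball_mean_isometry[OF _ lborel_distr_reflect_coord[of i]])
    show "?T \<in> borel \<rightarrow>\<^sub>M borel"
      by (intro borel_measurable_continuous_onI cont)
    show "norm (?T h) = norm h" for h
      unfolding norm_vec_def by (intro L2_set_cong) auto
    show "continuous_on (cball 0 r) f"
      using assms(1) by (rule continuous_on_subset) auto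
    show "continuous_on (cball 0 r) (\<lambda>h. f (?T h))"
      by (rule continuous_on_subset[OF continuous_on_compose2[OF assms(1) cont]]) auto
  qed
  moreover have "ball_mean 0 r (\<lambda>h. f (?T h)) = - ball_mean 0 r f"
    using ball_mean_mult_left[of 0 r "-1" f] by (simp add: odd)
  ultimately show ?thesis by simp
qed

lemma ball_mean_coord: "ball_mean 0 r (\<lambda>h :: real ^ 'n. h $ i) = 0"
  by (rule ball_mean_coord_odd[where i = i]) (auto intro!: continuous_intros)

lemma ball_mean_coord_mult:
  assumes "i \<noteq> j"
  shows "ball_mean 0 r (\<lambda>h :: real ^ 'n. h $ i * h $ j) = 0"
  by (rule ball_mean_coord_odd[where i = i]) (use assms in \<open>auto intro!: continuous_intros\<close>)

lemma ball_mean_coord_square_eq: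
  fixes i j :: "'n::finite"
  shows "ball_mean 0 r (\<lambda>h :: real ^ 'n. (h $ i)\<^sup>2) = ball_mean 0 r (\<lambda>h. (h $ j)\<^sup>2)"
proof -
  let ?T = "\<lambda>h :: real ^ 'n. \<chi> k. h $ Transposition.transpose i j k"
  have "ball_mean 0 r (\<lambda>h. (?T h $ j)\<^sup>2) = ball_mean 0 r (\<lambda>h. (h $ j)\<^sup>2)"
  proof (rule ball_mean_isometry[OF _ lborel_distr_permute_coords[of "Transposition.transpose i j"]])
    show "norm (?T h) = norm h" for h
      unfolding norm_vec_def L2_set_def
      using sum.reindex_bij_betw[of "Transposition.transpose i j" UNIV UNIV "\<lambda>k. (norm (h $ k))\<^sup>2"] by simp
  qed (auto intro!: borel_measurable_continuous_onI continuous_intros)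
  then show ?thesis by simp
qed

text \<open>
  The value follows from a scaling argument. Let \<open>M\<close> be the mean and \<open>V\<close> the volume of the
  unit ball. Scaling shows that the integral of \<open>|h|\<^sup>2\<close> over the annulus \<open>s \<le> |h| < 1\<close> is
  \<open>M (1 - s\<^sup>N\<^sup>+\<^sup>2) V\<close>. On the other hand the integrand lies between \<open>s\<^sup>2\<close> and \<open>1\<close> there, and the annulus
  has volume \<open>(1 - s\<^sup>N) V\<close>. Division by \<open>1 - s\<close> and \<open>s \<rightarrow> 1\<close> give \<open>M (N + 2) = N\<close>.
\<close>

lemma ball_mean_norm_square:
  "ball_mean 0 1 (\<lambda>h :: real ^ 'n. (norm h)\<^sup>2) = real CARD('n) / (real CARD('n) + 2)"
proof -
  let ?N = "CARD('n)"
  let ?q = "\<lambda>h :: real ^ 'n. (norm h)\<^sup>2"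
  define M where "M = ball_mean 0 1 ?q"
  define V where "V = measure lborel (ball (0 :: real ^ 'n) 1)"
  have "V > 0"
    unfolding V_def by (rule content_ball_pos) simp
  have cont: "continuous_on A ?q" for A
    by (intro continuous_intros)
  have vol: "measure lborel (ball (0 :: real ^ 'n) s) = s ^ ?N * V" if "0 < s" for s
    using content_ball_conv_unit_ball[of s "0 :: real ^ 'n"] that by (simp add: V_def)
  have int: "(LINT h:ball 0 s|lebesgue. ?q h) = M * s ^ (?N + 2) * V" if "0 < s" for s
  proof -
    have "ball_mean 0 s ?q = s\<^sup>2 * M"
      using ball_mean_rescale[OF that cont, of 0] ball_mean_mult_left[of 0 1 "s\<^sup>2" ?q] that
      by (simp add: M_def power_mult_distrib)
    then show ?thesis
      using \<open>V > 0\<close> that by (simp add: ball_mean_def vol power_add field_simps power2_eq_square)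
  qed
  have sandwich: "s\<^sup>2 * (1 - s ^ ?N) \<le> M * (1 - s ^ (?N + 2))"
    "M * (1 - s ^ (?N + 2)) \<le> 1 - s ^ ?N" if s: "0 < s" "s < 1" for s
  proof -
    let ?A = "ball (0 :: real ^ 'n) 1 - ball 0 s"
    have sub: "ball (0 :: real ^ 'n) s \<subseteq> ball 0 1"
      using s by auto
    have integrable: "set_integrable lebesgue (ball 0 1) ?q"
      by (intro set_integrable_ball_continuous cont)
    then have integrable_A: "set_integrable lebesgue ?A ?q"
      by (rule set_integrable_subset) auto
    have "(LINT h:ball 0 1|lebesgue. ?q h) = (LINT h:?A|lebesgue. ?q h) + (LINT h:ball 0 s|lebesgue. ?q h)"
      using set_integral_Un[of ?A "ball 0 s" lebesgue ?q] integrable_A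
        set_integrable_subset[OF integrable _ sub] sub
      by (simp add: Un_absorb2 Int_commute Diff_disjoint)
    then have annulus: "(LINT h:?A|lebesgue. ?q h) = M * (1 - s ^ (?N + 2)) * V"
      using int[of s] int[of 1] s by (simp add: algebra_simps)
    have "measure lebesgue ?A = measure lebesgue (ball (0 :: real ^ 'n) 1) - measure lebesgue (ball (0 :: real ^ 'n) s)"
      using sub emeasure_lborel_ball_finite[of "0 :: real ^ 'n" 1] by (intro measure_Diff) auto
    then have vol_A: "measure lebesgue ?A = (1 - s ^ ?N) * V"
      using vol[of s] vol[of 1] s by (simp add: algebra_simps)
    have fin: "emeasure lebesgue ?A < \<infinity>"
      using emeasure_lborel_ball_finite[of "0 :: real ^ 'n" 1]
      by (intro le_less_trans[OF emeasure_mono[of ?A "ball 0 1" lebesgue]]) auto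
    have const: "set_integrable lebesgue ?A (\<lambda>_. c)" "(LINT h:?A|lebesgue. c) = c * measure lebesgue ?A"
      for c :: real
      using fin by (auto simp: set_integrable_def set_lebesgue_integral_def)
    have "(LINT h:?A|lebesgue. s\<^sup>2) \<le> (LINT h:?A|lebesgue. ?q h)"
      using s by (intro set_integral_mono integrable_A const) (auto intro!: power_mono)
    then have "s\<^sup>2 * (1 - s ^ ?N) * V \<le> M * (1 - s ^ (?N + 2)) * V"
      by (simp only: annulus const vol_A mult.assoc)
    then show "s\<^sup>2 * (1 - s ^ ?N) \<le> M * (1 - s ^ (?N + 2))"
      using \<open>V > 0\<close> by (simp only: mult_le_cancel_right_pos)
    have "(LINT h:?A|lebesgue. ?q h) \<le> (LINT h:?A|lebesgue. 1)"
      using s by (intro set_integral_mono integrable_A const) (auto intro!: power_le_one)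
    then have "M * (1 - s ^ (?N + 2)) * V \<le> 1 * (1 - s ^ ?N) * V"
      by (simp only: annulus const vol_A mult.assoc)
    then show "M * (1 - s ^ (?N + 2)) \<le> 1 - s ^ ?N"
      using \<open>V > 0\<close> by (simp only: mult_le_cancel_right_pos mult_1_left)
  qed
  have quotient: "((\<lambda>s. (1 - s ^ n) / (1 - s)) \<longlongrightarrow> real n) (at_left (1 :: real))" for n
  proof -
    have "((\<lambda>s :: real. s ^ n) has_real_derivative real n) (at 1)"
      by (auto intro!: derivative_eq_intros)
    then have "((\<lambda>s :: real. (s ^ n - 1) / (s - 1)) \<longlongrightarrow> real n) (at 1)"
      by (simp add: has_field_derivative_iff)
    then have "((\<lambda>s :: real. (s ^ n - 1) / (s - 1)) \<longlongrightarrow> real n) (at_left 1)"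
      by (rule tendsto_within_subset) auto
    moreover have "(s ^ n - 1) / (s - 1) = (1 - s ^ n) / (1 - s)" for s :: real
      by (metis minus_diff_eq minus_divide_divide)
    ultimately show ?thesis by simp
  qed
  have near: "eventually (\<lambda>s. 0 < s \<and> s < 1) (at_left (1 :: real))"
    by (intro eventually_at_leftI[of 0]) auto
  have square: "((\<lambda>s. s\<^sup>2) \<longlongrightarrow> 1\<^sup>2) (at_left (1 :: real))"
    by (intro tendsto_intros)
  have "1\<^sup>2 * real ?N \<le> M * real (?N + 2)"
    by (rule tendsto_le[OF _ tendsto_mult_left[OF quotient] tendsto_mult[OF square quotient]])
      (use near sandwich(1) in \<open>auto elim!: eventually_mono simp: divide_simps\<close>)
  moreover have "M * real (?N + 2) \<le> real ?N"
    by (rule tendsto_le[OF _ quotient tendsto_mult_left[OF quotient]])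
      (use near sandwich(2) in \<open>auto elim!: eventually_mono simp: divide_simps\<close>)
  ultimately show ?thesis
    by (simp add: M_def[symmetric] field_simps)
qed

text \<open>
  The \<open>N\<close> coordinates have equal second moments, which sum to the mean of \<open>|h|\<^sup>2\<close>.
\<close>

lemma ball_mean_coord_square:
  "ball_mean 0 1 (\<lambda>h :: real ^ 'n. (h $ i)\<^sup>2) = 1 / (real CARD('n) + 2)"
proof -
  have "(\<lambda>h :: real ^ 'n. (norm h)\<^sup>2) = (\<lambda>h. \<Sum>j\<in>UNIV. (h $ j)\<^sup>2)"
    by (simp add: fun_eq_iff norm_vec_def L2_set_def sum_nonneg)
  then have "ball_mean 0 1 (\<lambda>h :: real ^ 'n. (norm h)\<^sup>2) = (\<Sum>j\<in>UNIV. ball_mean 0 1 (\<lambda>h :: real ^ 'n. (h $ j)\<^sup>2))"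
    by (simp add: ball_mean_sum continuous_intros)
  also have "\<dots> = (\<Sum>j\<in>(UNIV :: 'n set). ball_mean 0 1 (\<lambda>h :: real ^ 'n. (h $ i)\<^sup>2))"
    by (rule sum.cong[OF refl ball_mean_coord_square_eq])
  finally have "real CARD('n) * ball_mean 0 1 (\<lambda>h :: real ^ 'n. (h $ i)\<^sup>2)
      = real CARD('n) * (1 / (real CARD('n) + 2))"
    by (simp add: ball_mean_norm_square)
  then show ?thesis
    by (simp only: mult_cancel_left) simp
qed

text \<open>
  The mixed moments vanish, so only the diagonal of \<open>H\<close> is left.
\<close>

lemma ball_mean_quadratic_form:
  fixes H :: "real ^ 'n ^ 'n"
  shows "ball_mean 0 1 (\<lambda>h. (H *v h) \<bullet> h) = trace H / (real CARD('n) + 2)"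
proof -
  have "(\<lambda>h. (H *v h) \<bullet> h) = (\<lambda>h. \<Sum>i\<in>UNIV. \<Sum>j\<in>UNIV. H $ i $ j * (h $ j * h $ i))"
    by (simp add: fun_eq_iff inner_vec_def matrix_vector_mult_def sum_distrib_right mult.assoc)
  then have "ball_mean 0 1 (\<lambda>h. (H *v h) \<bullet> h)
      = (\<Sum>i\<in>UNIV. \<Sum>j\<in>UNIV. H $ i $ j * ball_mean 0 1 (\<lambda>h :: real ^ 'n. h $ j * h $ i))"
    by (simp add: ball_mean_sum ball_mean_mult_left continuous_intros)
  also have "\<dots> = (\<Sum>i\<in>UNIV. \<Sum>j\<in>UNIV. if j = i then H $ i $ i / (real CARD('n) + 2) else 0)"
    by (intro sum.cong refl)
      (auto simp: ball_mean_coord_mult ball_mean_coord_square[unfolded power2_eq_square])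
  also have "\<dots> = trace H / (real CARD('n) + 2)"
    by (simp add: trace_def sum_divide_distrib)
  finally show ?thesis .
qed

lemma ball_mean_linear_form: "ball_mean 0 1 (\<lambda>h :: real ^ 'n. g \<bullet> h) = 0"
proof -
  have "ball_mean 0 1 (\<lambda>h :: real ^ 'n. g \<bullet> h)
      = (\<Sum>i\<in>UNIV. g $ i * ball_mean 0 1 (\<lambda>h :: real ^ 'n. h $ i))"
    by (simp add: inner_vec_def ball_mean_sum ball_mean_mult_left continuous_intros)
  then show ?thesis
    by (simp add: ball_mean_coord)
qed

section \<open>Asymptotics of the means\<close>

lemma ball_mean_quadratic_polynomial:
  fixes H :: "real ^ 'n ^ 'n"
  assumes "0 < r"
  shows "ball_mean x r (\<lambda>y. c + g \<bullet> (y - x) + (H *v (y - x)) \<bullet> (y - x) / 2)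
    = c + r\<^sup>2 * trace H / (2 * (real CARD('n) + 2))"
proof -
  have contH: "continuous_on A (\<lambda>h. H *v h)" for A
    by (intro linear_continuous_on matrix_vector_mul_bounded_linear)
  have "continuous_on (cball x r) (\<lambda>y. c + g \<bullet> (y - x) + (H *v (y - x)) \<bullet> (y - x) / 2)"
    by (intro continuous_intros continuous_on_compose2[OF contH[of UNIV]]) auto
  then have "ball_mean x r (\<lambda>y. c + g \<bullet> (y - x) + (H *v (y - x)) \<bullet> (y - x) / 2)
      = ball_mean 0 1 (\<lambda>h. c + r * (g \<bullet> h) + r\<^sup>2 / 2 * ((H *v h) \<bullet> h))"
    by (subst ball_mean_rescale[OF assms])
      (simp_all add: matrix_vector_mult_scaleR power2_eq_square mult.assoc)
  also have "\<dots> = c + r * 0 + r\<^sup>2 / 2 * (trace H / (real CARD('n) + 2))"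
    by (simp only: ball_mean_add ball_mean_mult_left ball_mean_const ball_mean_linear_form
        ball_mean_quadratic_form zero_less_one contH continuous_intros)
  finally show ?thesis by simp
qed

text \<open>
  The Taylor polynomial has an exactly known mean, and replacing \<open>f\<close> by it changes the mean
  by \<open>o(r\<^sup>2)\<close>. Continuity of \<open>f\<close> makes it integrable over small balls.
\<close>

lemma ball_mean_expansion:
  fixes f :: "real ^ 'n \<Rightarrow> real"
  assumes jet: "second_order_jet f x g H"
    and "open S" and "x \<in> S" and cont: "continuous_on S f"
  shows "((\<lambda>r. (ball_mean x r f - f x) / r\<^sup>2)
    \<longlongrightarrow> trace H / (2 * (real CARD('n) + 2))) (at_right 0)"
proof (rule tendstoI)
  fix e :: real assume "e > 0"
  obtain d where "d > 0" and d: "\<And>h. norm h < d \<Longrightarrow>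
      \<bar>f (x + h) - (f x + g \<bullet> h + (H *v h) \<bullet> h / 2)\<bar> \<le> e / 2 * (norm h)\<^sup>2"
    using jet \<open>e > 0\<close> unfolding second_order_jet_def by (metis half_gt_zero)
  obtain d' where "d' > 0" and d': "cball x d' \<subseteq> S"
    using \<open>open S\<close> \<open>x \<in> S\<close> open_contains_cball by blast
  have "eventually (\<lambda>r. r < min d d') (at_right (0::real))"
    using \<open>d > 0\<close> \<open>d' > 0\<close> by (intro eventually_at_rightI[of 0 "min d d'"]) auto
  then show "eventually (\<lambda>r. dist ((ball_mean x r f - f x) / r\<^sup>2)
      (trace H / (2 * (real CARD('n) + 2))) < e) (at_right 0)"
    using eventually_at_right_less[of 0]
  proof eventually_elim
    case (elim r)
    let ?q = "\<lambda>y. f x + g \<bullet> (y - x) + (H *v (y - x)) \<bullet> (y - x) / 2"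
    have contH: "continuous_on UNIV (\<lambda>h. H *v h)"
      by (intro linear_continuous_on matrix_vector_mul_bounded_linear)
    have "\<bar>ball_mean x r f - ball_mean x r ?q\<bar> \<le> e / 2 * r\<^sup>2"
    proof (rule abs_ball_mean_diff_le)
      show "continuous_on (cball x r) f"
        using elim d' by (intro continuous_on_subset[OF cont]) auto
      show "continuous_on (cball x r) ?q"
        by (intro continuous_intros continuous_on_compose2[OF contH]) auto
      show "\<bar>f y - ?q y\<bar> \<le> e / 2 * r\<^sup>2" if "y \<in> ball x r" for y
      proof -
        have "norm (y - x) < r"
          using that by (simp add: dist_norm norm_minus_commute)
        then have "\<bar>f y - ?q y\<bar> \<le> e / 2 * (norm (y - x))\<^sup>2"
          using d[of "y - x"] elim by simp
        also have "\<dots> \<le> e / 2 * r\<^sup>2"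
          using \<open>norm (y - x) < r\<close> \<open>e > 0\<close> by (intro mult_left_mono power_mono) auto
        finally show ?thesis .
      qed
    qed (use elim in auto)
    moreover have "e / 2 * r\<^sup>2 < e * r\<^sup>2"
      using \<open>e > 0\<close> elim by simp
    ultimately have abs: "\<bar>ball_mean x r f - ball_mean x r ?q\<bar> < e * r\<^sup>2"
      by linarith
    have eq: "(ball_mean x r f - f x) / r\<^sup>2 - trace H / (2 * (real CARD('n) + 2))
        = (ball_mean x r f - ball_mean x r ?q) / r\<^sup>2"
      using elim by (subst ball_mean_quadratic_polynomial) (auto simp: diff_divide_distrib add_divide_distrib)
    show ?case
      unfolding dist_real_def eq using elim abs by (simp add: abs_divide pos_divide_less_eq)
  qed
qed

text \<open>
  For \<open>y\<close> in the ball, the points \<open>y \<plusminus> r v\<close> have distance at most \<open>r (1 + |v|)\<close> from \<open>x\<close>. There \<open>f\<close> equals its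
  affine approximation up to \<open>o(r)\<close>, and for the affine approximation the difference is the
  constant \<open>2 r (v \<bullet> g)\<close>.
\<close>

lemma ball_mean_shift_difference_expansion:
  fixes f :: "real ^ 'n \<Rightarrow> real"
  assumes deriv: "GDERIV f x :> g"
    and "open S" and "x \<in> S" and cont: "continuous_on S f"
  shows "((\<lambda>r. ball_mean x r (\<lambda>y. f (y + r *\<^sub>R v) - f (y - r *\<^sub>R v)) / r)
    \<longlongrightarrow> 2 * (v \<bullet> g)) (at_right 0)"
proof (rule tendstoI)
  fix e :: real assume "e > 0"
  define K where "K = 1 + norm v"
  have "K > 0" by (simp add: K_def add_pos_nonneg)
  define \<delta> where "\<delta> = e / (4 * K)"
  have "\<delta> > 0" using \<open>e > 0\<close> \<open>K > 0\<close> by (simp add: \<delta>_def)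
  have "(f has_derivative (\<lambda>h. h \<bullet> g)) (at x)"
    using deriv by (simp add: gderiv_def)
  with \<open>\<delta> > 0\<close> obtain d where "d > 0" and d: "\<And>y. norm (y - x) < d \<Longrightarrow>
      norm (f y - f x - (y - x) \<bullet> g) \<le> \<delta> * norm (y - x)"
    unfolding has_derivative_at_alt by blast
  obtain d' where "d' > 0" and d': "ball x d' \<subseteq> S"
    using \<open>open S\<close> \<open>x \<in> S\<close> open_contains_ball by blast
  have "eventually (\<lambda>r. r < min d d' / K) (at_right (0::real))"
    using \<open>d > 0\<close> \<open>d' > 0\<close> \<open>K > 0\<close> by (intro eventually_at_rightI[of 0 "min d d' / K"]) auto
  then show "eventually (\<lambda>r. dist (ball_mean x r (\<lambda>y. f (y + r *\<^sub>R v) - f (y - r *\<^sub>R v)) / r)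
      (2 * (v \<bullet> g)) < e) (at_right 0)"
    using eventually_at_right_less[of 0]
  proof eventually_elim
    case (elim r)
    have rK: "r * K < min d d'"
      using elim(1) \<open>K > 0\<close> by (simp only: pos_less_divide_eq)
    have near: "norm (y + t *\<^sub>R v - x) \<le> r * K" if "y \<in> cball x r" "\<bar>t\<bar> \<le> r" for y t
    proof -
      have "norm (y + t *\<^sub>R v - x) \<le> norm (y - x) + \<bar>t\<bar> * norm v"
        using norm_triangle_ineq[of "y - x" "t *\<^sub>R v"] by (simp add: algebra_simps)
      also have "\<dots> \<le> r + r * norm v"
        using that by (intro add_mono mult_right_mono) (auto simp: dist_norm norm_minus_commute)
      finally show ?thesis by (simp add: K_def algebra_simps)
    qed
    have contf: "continuous_on (cball x r) (\<lambda>y. f (y + t *\<^sub>R v))" if "\<bar>t\<bar> \<le> r" for t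
    proof (intro continuous_on_compose2[OF cont] continuous_intros subsetI, elim imageE)
      fix z y assume "y \<in> cball x r" "z = y + t *\<^sub>R v"
      then have "z \<in> ball x d'"
        using near[OF _ that, of y] rK by (simp add: dist_norm norm_minus_commute)
      then show "z \<in> S" using d' by blast
    qed
    let ?f = "\<lambda>y. f (y + r *\<^sub>R v) - f (y - r *\<^sub>R v)"
    have "\<bar>ball_mean x r ?f - ball_mean x r (\<lambda>y. 2 * r * (v \<bullet> g))\<bar> \<le> 2 * \<delta> * (r * K)"
    proof (rule abs_ball_mean_diff_le)
      show "continuous_on (cball x r) ?f"
        using contf[of r] contf[of "-r"] elim by (intro continuous_on_diff) auto
      show "\<bar>?f y - 2 * r * (v \<bullet> g)\<bar> \<le> 2 * \<delta> * (r * K)" if "y \<in> ball x r" for y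
      proof -
        have affine: "\<bar>f (y + t *\<^sub>R v) - f x - (y + t *\<^sub>R v - x) \<bullet> g\<bar> \<le> \<delta> * (r * K)"
          if "\<bar>t\<bar> \<le> r" for t
        proof -
          have "norm (y + t *\<^sub>R v - x) \<le> r * K"
            using near that \<open>y \<in> ball x r\<close> by auto
          then show ?thesis
            using d[of "y + t *\<^sub>R v"] rK \<open>\<delta> > 0\<close>
            by (smt (verit) mult_left_mono real_norm_def)
        qed
        have "?f y - 2 * r * (v \<bullet> g) = (f (y + r *\<^sub>R v) - f x - (y + r *\<^sub>R v - x) \<bullet> g)
            - (f (y + (- r) *\<^sub>R v) - f x - (y + (- r) *\<^sub>R v - x) \<bullet> g)"
          by (simp add: algebra_simps inner_diff_left inner_add_left)
        then show ?thesis
          using affine[of r] affine[of "- r"] elim by linarith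
      qed
    qed (use elim in auto)
    also have "2 * \<delta> * (r * K) < e * r"
      using \<open>e > 0\<close> \<open>K > 0\<close> elim by (simp add: \<delta>_def)
    finally have "\<bar>ball_mean x r ?f - 2 * r * (v \<bullet> g)\<bar> < e * r"
      using elim by (simp add: ball_mean_const)
    moreover have "ball_mean x r ?f / r - 2 * (v \<bullet> g) = (ball_mean x r ?f - 2 * r * (v \<bullet> g)) / r"
      using elim by (simp add: field_simps)
    ultimately show ?case
      using elim by (simp add: dist_real_def abs_divide pos_divide_less_eq)
  qed
qed

section \<open>The limit of the expansion error\<close>

text \<open>
  The weights are those determined by \<open>\<alpha> + \<beta> = 1\<close> and \<open>\<alpha> / \<beta> = (p - 2) / (N + 2)\<close>. Because they
  sum to \<open>1\<close>, the value \<open>\<phi> x\<close> can be distributed over the individual expansions; the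
  terms \<open>\<plusminus> \<epsilon> |g|\<close> of the maximum and of the minimum cancel.
\<close>

lemma expansion_error_limit:
  fixes \<phi> a :: "real ^ 'n \<Rightarrow> real"
  assumes "open S" and "x \<in> S" and C2: "C2_on S \<phi>" and "grad \<phi> x \<noteq> 0"
    and "a x > 0" and "real CARD('n) + p > 0"
    and \<alpha>: "\<alpha> = (p - 2) / (real CARD('n) + p)"
    and \<beta>: "\<beta> = (real CARD('n) + 2) / (real CARD('n) + p)"
  shows "((\<lambda>\<epsilon>. expansion_error p \<alpha> \<beta> a \<phi> x \<epsilon> / \<epsilon>\<^sup>2)
    \<longlongrightarrow> - weighted_p_operator p a \<phi> x / (2 * (real CARD('n) + p) * a x)) (at_right 0)"
proof -
  let ?N = "real CARD('n)"
  let ?g = "grad \<phi> x" and ?H = "hessian \<phi> x" and ?v = "grad a x"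
  let ?c = "1 / (4 * (?N + p) * a x)"
  have diff: "\<phi> differentiable (at y)" if "y \<in> S" for y
    using C2 that by (simp add: C2_on_def C1_on_def)
  have jet: "second_order_jet \<phi> x ?g ?H"
    using C2 diff \<open>x \<in> S\<close> \<open>open S\<close>
    by (intro second_order_jet_grad_hessian[of S]) (auto simp: C2_on_def)
  have cont: "continuous_on S \<phi>"
    using diff by (intro continuous_at_imp_continuous_on ballI differentiable_imp_continuous_within)
  let ?sup = "\<lambda>\<epsilon>. SUP y\<in>cball x \<epsilon>. \<phi> y" and ?inf = "\<lambda>\<epsilon>. INF y\<in>cball x \<epsilon>. \<phi> y"
  let ?shift = "\<lambda>\<epsilon>. ball_mean x \<epsilon> (\<lambda>y. \<phi> (y + \<epsilon> *\<^sub>R ?v) - \<phi> (y - \<epsilon> *\<^sub>R ?v))"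
  let ?Q = "\<lambda>\<epsilon>. \<alpha> / 2 * ((?sup \<epsilon> - \<phi> x - \<epsilon> * norm ?g) / \<epsilon>\<^sup>2 + (?inf \<epsilon> - \<phi> x + \<epsilon> * norm ?g) / \<epsilon>\<^sup>2)
        + \<beta> * ((ball_mean x \<epsilon> \<phi> - \<phi> x) / \<epsilon>\<^sup>2) + ?c * (?shift \<epsilon> / \<epsilon>)"
  have lim: "(?Q
      \<longlongrightarrow> \<alpha> / 2 * (inf_laplacian \<phi> x / 2 + inf_laplacian \<phi> x / 2)
        + \<beta> * (laplacian \<phi> x / (2 * (?N + 2))) + ?c * (2 * (?v \<bullet> ?g))) (at_right 0)"
    unfolding inf_laplacian_def laplacian_def
    by (intro tendsto_intros cSUP_cball_expansion[OF jet] cINF_cball_expansion[OF jet]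
        ball_mean_expansion[OF jet \<open>open S\<close> \<open>x \<in> S\<close> cont]
        ball_mean_shift_difference_expansion[OF gderiv_grad[OF diff[OF \<open>x \<in> S\<close>]] \<open>open S\<close> \<open>x \<in> S\<close> cont]
        assms)
  have sum: "\<alpha> + \<beta> = 1"
    using assms(6) by (simp add: \<alpha> \<beta> add_divide_distrib[symmetric])
  have eq: "?Q \<epsilon> = expansion_error p \<alpha> \<beta> a \<phi> x \<epsilon> / \<epsilon>\<^sup>2" if "0 < \<epsilon>" for \<epsilon>
  proof -
    have shift: "?shift \<epsilon> / \<epsilon> = \<epsilon> * ?shift \<epsilon> / \<epsilon>\<^sup>2"
      using that by (simp add: power2_eq_square)
    have "?Q \<epsilon> = (- ((\<alpha> + \<beta>) * \<phi> x) + \<alpha> / 2 * (?sup \<epsilon> + ?inf \<epsilon>) + \<beta> * ball_mean x \<epsilon> \<phi>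
          + \<epsilon> * ?c * ?shift \<epsilon>) / \<epsilon>\<^sup>2"
      unfolding shift by (simp only: add_divide_distrib diff_divide_distrib ring_distribs
          minus_divide_left[symmetric] times_divide_eq_right) (simp add: mult_ac)
    then show ?thesis
      by (simp add: sum expansion_error_def)
  qed
  have value_eq: "\<alpha> / 2 * (inf_laplacian \<phi> x / 2 + inf_laplacian \<phi> x / 2)
        + \<beta> * (laplacian \<phi> x / (2 * (?N + 2))) + ?c * (2 * (?v \<bullet> ?g))
      = - weighted_p_operator p a \<phi> x / (2 * (?N + p) * a x)"
  proof -
    have "\<beta> * (laplacian \<phi> x / (2 * (?N + 2))) = laplacian \<phi> x / (2 * (?N + p))"
    proof -
      have "b / c * (l / (2 * b)) = l / (2 * c)" if "b \<noteq> 0" for b c l :: real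
        using that by simp
      from this[of "?N + 2"] show ?thesis
        unfolding \<beta> by (simp del: times_divide_times_eq)
    qed
    moreover have "q / M / 2 * (I / 2 + I / 2) + L / (2 * M) + 1 / (4 * M * A) * (2 * w)
        = - (- A * (q * I + L) - w) / (2 * M * A)" if "M \<noteq> 0" "A \<noteq> 0" for q M I L A w :: real
      using that by (simp add: field_simps)
    moreover have "?N + p \<noteq> 0" "a x \<noteq> 0"
      using assms by auto
    ultimately show ?thesis
      unfolding weighted_p_operator_def \<alpha> by metis
  qed
  have "eventually (\<lambda>\<epsilon>. ?Q \<epsilon> = expansion_error p \<alpha> \<beta> a \<phi> x \<epsilon> / \<epsilon>\<^sup>2) (at_right 0)"
    using eventually_at_right_less[of 0] by (rule eventually_mono) (rule eq)
  from tendsto_cong[OF this] lim show ?thesis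
    unfolding value_eq by simp
qed

section \<open>Signs up to a correction of lower order\<close>

lemma little_o_correction_le_iff:
  fixes E :: "real \<Rightarrow> real"
  assumes lim: "((\<lambda>\<epsilon>. E \<epsilon> / \<epsilon>\<^sup>2) \<longlongrightarrow> L) (at_right 0)"
  shows "(\<exists>r. ((\<lambda>\<epsilon>. r \<epsilon> / \<epsilon>\<^sup>2) \<longlongrightarrow> 0) (at_right 0) \<and>
      (\<forall>\<^sub>F \<epsilon> in at_right 0. E \<epsilon> + r \<epsilon> \<le> 0)) \<longleftrightarrow> L \<le> 0"
proof
  assume "\<exists>r. ((\<lambda>\<epsilon>. r \<epsilon> / \<epsilon>\<^sup>2) \<longlongrightarrow> 0) (at_right 0) \<and> (\<forall>\<^sub>F \<epsilon> in at_right 0. E \<epsilon> + r \<epsilon> \<le> 0)"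
  then obtain r where r: "((\<lambda>\<epsilon>. r \<epsilon> / \<epsilon>\<^sup>2) \<longlongrightarrow> 0) (at_right 0)"
    and le: "\<forall>\<^sub>F \<epsilon> in at_right 0. E \<epsilon> + r \<epsilon> \<le> 0" by blast
  have "((\<lambda>\<epsilon>. E \<epsilon> / \<epsilon>\<^sup>2 + r \<epsilon> / \<epsilon>\<^sup>2) \<longlongrightarrow> L + 0) (at_right 0)"
    by (intro tendsto_add lim r)
  moreover have "\<forall>\<^sub>F \<epsilon> in at_right 0. E \<epsilon> / \<epsilon>\<^sup>2 + r \<epsilon> / \<epsilon>\<^sup>2 \<le> 0"
    using le by (rule eventually_mono)
      (simp add: add_divide_distrib[symmetric] divide_nonpos_nonneg)
  ultimately have "L + 0 \<le> 0"
    by (rule tendsto_upperbound) simp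
  then show "L \<le> 0" by simp
next
  assume "L \<le> 0"
  \<comment> \<open>This correction replaces \<open>E\<close> by its leading term \<open>L \<epsilon>\<^sup>2\<close>, which already has the right sign.\<close>
  let ?r = "\<lambda>\<epsilon>. L * \<epsilon>\<^sup>2 - E \<epsilon>"
  have "((\<lambda>\<epsilon>. L - E \<epsilon> / \<epsilon>\<^sup>2) \<longlongrightarrow> L - L) (at_right 0)"
    by (intro tendsto_diff lim tendsto_const)
  moreover have "\<forall>\<^sub>F \<epsilon> in at_right 0. L - E \<epsilon> / \<epsilon>\<^sup>2 = ?r \<epsilon> / \<epsilon>\<^sup>2"
    using eventually_at_right_less[of 0] by (rule eventually_mono) (simp add: diff_divide_distrib)
  ultimately have "((\<lambda>\<epsilon>. ?r \<epsilon> / \<epsilon>\<^sup>2) \<longlongrightarrow> 0) (at_right 0)"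
    by (simp add: tendsto_cong)
  moreover have "E \<epsilon> + ?r \<epsilon> \<le> 0" for \<epsilon>
    using \<open>L \<le> 0\<close> by (simp add: mult_nonpos_nonneg)
  ultimately show "\<exists>r. ((\<lambda>\<epsilon>. r \<epsilon> / \<epsilon>\<^sup>2) \<longlongrightarrow> 0) (at_right 0) \<and>
      (\<forall>\<^sub>F \<epsilon> in at_right 0. E \<epsilon> + r \<epsilon> \<le> 0)"
    by (intro exI[of _ ?r] conjI) auto
qed

lemma little_o_correction_ge_iff:
  fixes E :: "real \<Rightarrow> real"
  assumes lim: "((\<lambda>\<epsilon>. E \<epsilon> / \<epsilon>\<^sup>2) \<longlongrightarrow> L) (at_right 0)"
  shows "(\<exists>r. ((\<lambda>\<epsilon>. r \<epsilon> / \<epsilon>\<^sup>2) \<longlongrightarrow> 0) (at_right 0) \<and>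
      (\<forall>\<^sub>F \<epsilon> in at_right 0. E \<epsilon> + r \<epsilon> \<ge> 0)) \<longleftrightarrow> L \<ge> 0" (is "?lhs \<longleftrightarrow> _")
proof -
  have "((\<lambda>\<epsilon>. - E \<epsilon> / \<epsilon>\<^sup>2) \<longlongrightarrow> - L) (at_right 0)"
    using tendsto_minus[OF lim] by simp
  note iff = little_o_correction_le_iff[OF this]
  have "?lhs \<longleftrightarrow> (\<exists>r. ((\<lambda>\<epsilon>. r \<epsilon> / \<epsilon>\<^sup>2) \<longlongrightarrow> 0) (at_right 0) \<and>
      (\<forall>\<^sub>F \<epsilon> in at_right 0. - E \<epsilon> + r \<epsilon> \<le> 0))" (is "_ \<longleftrightarrow> ?rhs")
  proof
    assume ?lhs
    then obtain r where "((\<lambda>\<epsilon>. r \<epsilon> / \<epsilon>\<^sup>2) \<longlongrightarrow> 0) (at_right 0)"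
      and "\<forall>\<^sub>F \<epsilon> in at_right 0. E \<epsilon> + r \<epsilon> \<ge> 0" by blast
    then show ?rhs
      using tendsto_minus[of "\<lambda>\<epsilon>. r \<epsilon> / \<epsilon>\<^sup>2" 0]
      by (intro exI[of _ "\<lambda>\<epsilon>. - r \<epsilon>"]) (auto elim: eventually_mono)
  next
    assume ?rhs
    then obtain r where "((\<lambda>\<epsilon>. r \<epsilon> / \<epsilon>\<^sup>2) \<longlongrightarrow> 0) (at_right 0)"
      and "\<forall>\<^sub>F \<epsilon> in at_right 0. - E \<epsilon> + r \<epsilon> \<le> 0" by blast
    then show ?lhs
      using tendsto_minus[of "\<lambda>\<epsilon>. r \<epsilon> / \<epsilon>\<^sup>2" 0]
      by (intro exI[of _ "\<lambda>\<epsilon>. - r \<epsilon>"]) (auto elim: eventually_mono)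
  qed
  with iff show ?thesis by simp
qed

section \<open>The equivalence\<close>

lemma grad_add_const:
  fixes \<phi> :: "real ^ 'n \<Rightarrow> real"
  shows "grad (\<lambda>y. \<phi> y + c) = grad \<phi>"
proof -
  have "((\<lambda>y. \<phi> y + c) has_derivative D) F \<longleftrightarrow> (\<phi> has_derivative D) F" for D F
    using has_derivative_add_const[of \<phi> D F c]
      has_derivative_add_const[of "\<lambda>y. \<phi> y + c" D F "- c"] by auto
  then show ?thesis
    by (simp add: grad_def frechet_derivative_def fun_eq_iff)
qed

lemma C2_on_add_const: "C2_on S (\<lambda>y. \<phi> y + c) \<longleftrightarrow> C2_on S \<phi>"
proof -
  have "(\<lambda>y. \<phi> y + c) differentiable F \<longleftrightarrow> \<phi> differentiable F" for F
    using differentiable_add[of \<phi> F "\<lambda>_. c"]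
      differentiable_add[of "\<lambda>y. \<phi> y + c" F "\<lambda>_. - c"] by auto
  then show ?thesis
    by (simp add: C2_on_def C1_on_def grad_add_const hessian_def[abs_def])
qed

lemma weighted_p_operator_add_const:
  "weighted_p_operator p a (\<lambda>y. \<phi> y + c) x = weighted_p_operator p a \<phi> x"
  by (simp add: weighted_p_operator_def inf_laplacian_def laplacian_def hessian_def grad_add_const)

theorem corollary3p3:
  fixes \<Omega> :: "(real ^ 'n) set"
    and p \<alpha> \<beta> :: real
    and a u :: "real ^ 'n \<Rightarrow> real"
  assumes "CARD('n) \<ge> 2"
    and "open \<Omega>" and "connected \<Omega>" and "\<Omega> \<noteq> {}"
    and "1 < p"
    and "C1_on \<Omega> a" and "\<forall>x\<in>\<Omega>. a x \<ge> 1"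
    and "continuous_on \<Omega> u"
    and "\<alpha> + \<beta> = 1" and "\<beta> \<noteq> 0" and "\<alpha> / \<beta> = (p - 2) / (real CARD('n) + 2)"
  shows "viscosity_solution \<Omega> p a u \<longleftrightarrow>
    (\<forall>x\<in>\<Omega>. expansion_holds_viscosity \<Omega> p \<alpha> \<beta> a u x)"
proof -
  let ?N = "real CARD('n)"
  have pos: "?N + p > 0"
    using \<open>1 < p\<close> by simp
  have "\<alpha> * (?N + 2) = (p - 2) * \<beta>"
    using assms(10,11) by (simp add: field_simps)
  then have "\<beta> * (?N + p) = ?N + 2"
    using assms(9) by algebra
  then have \<beta>: "\<beta> = (?N + 2) / (?N + p)"
    using pos by (simp add: field_simps)
  have "\<alpha> = 1 - \<beta>"
    using assms(9) by simp
  then have \<alpha>: "\<alpha> = (p - 2) / (?N + p)"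
    using pos unfolding \<beta> by (simp add: field_simps)
  have lim: "((\<lambda>\<epsilon>. expansion_error p \<alpha> \<beta> a \<phi> x \<epsilon> / \<epsilon>\<^sup>2)
      \<longlongrightarrow> - weighted_p_operator p a \<phi> x / (2 * (?N + p) * a x)) (at_right 0)"
    and pos_a: "2 * (?N + p) * a x > 0"
    if "x \<in> \<Omega>" "C2_on \<Omega> \<phi>" "grad \<phi> x \<noteq> 0" for \<phi> x
  proof -
    have "a x > 0"
      using assms(7) \<open>x \<in> \<Omega>\<close> by fastforce
    then show "2 * (?N + p) * a x > 0"
      using pos by simp
    show "((\<lambda>\<epsilon>. expansion_error p \<alpha> \<beta> a \<phi> x \<epsilon> / \<epsilon>\<^sup>2)
        \<longlongrightarrow> - weighted_p_operator p a \<phi> x / (2 * (?N + p) * a x)) (at_right 0)"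
      by (intro expansion_error_limit[of \<Omega>] \<open>open \<Omega>\<close> that \<open>a x > 0\<close> pos \<alpha> \<beta>)
  qed
  have min_iff: "(\<exists>r. ((\<lambda>\<epsilon>. r \<epsilon> / \<epsilon>\<^sup>2) \<longlongrightarrow> 0) (at_right 0) \<and>
        (\<forall>\<^sub>F \<epsilon> in at_right 0. expansion_error p \<alpha> \<beta> a \<phi> x \<epsilon> + r \<epsilon> \<le> 0))
      \<longleftrightarrow> weighted_p_operator p a \<phi> x \<ge> 0"
    if "x \<in> \<Omega>" "C2_on \<Omega> \<phi>" "grad \<phi> x \<noteq> 0" for \<phi> x
    unfolding little_o_correction_le_iff[OF lim[OF that]]
    using pos_a[OF that] by (simp add: divide_le_0_iff zero_le_divide_iff)
  have max_iff: "(\<exists>r. ((\<lambda>\<epsilon>. r \<epsilon> / \<epsilon>\<^sup>2) \<longlongrightarrow> 0) (at_right 0) \<and>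
        (\<forall>\<^sub>F \<epsilon> in at_right 0. expansion_error p \<alpha> \<beta> a \<phi> x \<epsilon> + r \<epsilon> \<ge> 0))
      \<longleftrightarrow> weighted_p_operator p a \<phi> x \<le> 0"
    if "x \<in> \<Omega>" "C2_on \<Omega> \<phi>" "grad \<phi> x \<noteq> 0" for \<phi> x
    unfolding little_o_correction_ge_iff[OF lim[OF that]]
    using pos_a[OF that] by (simp add: divide_le_0_iff zero_le_divide_iff)
  show ?thesis
    unfolding viscosity_solution_def expansion_holds_viscosity_def
  proof (intro ball_cong refl arg_cong2[where f = "(\<and>)"])
    fix x assume "x \<in> \<Omega>"
    \<comment> \<open>The expansion is only tested with functions that touch \<open>u\<close> at \<open>x\<close>; adding the constant
      \<open>u x - \<phi> x\<close> brings any test function for the equation into this form.\<close>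
    define T where "T \<phi> y = \<phi> y + (u x - \<phi> x)" for \<phi> :: "real ^ 'n \<Rightarrow> real" and y
    have T: "u x = T \<phi> x" "grad (T \<phi>) = grad \<phi>" "C2_on \<Omega> (T \<phi>) \<longleftrightarrow> C2_on \<Omega> \<phi>"
      "weighted_p_operator p a (T \<phi>) x = weighted_p_operator p a \<phi> x" for \<phi>
      by (simp_all add: T_def[abs_def] grad_add_const C2_on_add_const weighted_p_operator_add_const)
    have T_strict:
      "strict_min_at \<Omega> (\<lambda>y. u y - T \<phi> y) x \<longleftrightarrow> strict_min_at \<Omega> (\<lambda>y. u y - \<phi> y) x"
      "strict_max_at \<Omega> (\<lambda>y. u y - T \<phi> y) x \<longleftrightarrow> strict_max_at \<Omega> (\<lambda>y. u y - \<phi> y) x" for \<phi>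
      by (simp_all add: T_def strict_min_at_def strict_max_at_def algebra_simps)
    have normalize: "(\<forall>\<phi>. P \<phi> \<longrightarrow> R \<phi>) \<longleftrightarrow> (\<forall>\<phi>. P \<phi> \<and> u x = \<phi> x \<longrightarrow> R \<phi>)"
      if "\<And>\<phi>. P (T \<phi>) = P \<phi>" "\<And>\<phi>. R (T \<phi>) = R \<phi>" for P R
      using that T(1) by metis
    have "(\<forall>\<phi>. C2_on \<Omega> \<phi> \<and> strict_min_at \<Omega> (\<lambda>y. u y - \<phi> y) x \<and> grad \<phi> x \<noteq> 0
           \<longrightarrow> weighted_p_operator p a \<phi> x \<ge> 0) \<longleftrightarrow>
        (\<forall>\<phi>. (C2_on \<Omega> \<phi> \<and> strict_min_at \<Omega> (\<lambda>y. u y - \<phi> y) x \<and> grad \<phi> x \<noteq> 0) \<and> u x = \<phi> x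
           \<longrightarrow> weighted_p_operator p a \<phi> x \<ge> 0)"
      by (rule normalize) (simp_all add: T T_strict)
    also have "\<dots> \<longleftrightarrow> (\<forall>\<phi>. C2_on \<Omega> \<phi> \<and> strict_min_at \<Omega> (\<lambda>y. u y - \<phi> y) x \<and> u x = \<phi> x \<and> grad \<phi> x \<noteq> 0
           \<longrightarrow> (\<exists>r. ((\<lambda>\<epsilon>. r \<epsilon> / \<epsilon>\<^sup>2) \<longlongrightarrow> 0) (at_right 0) \<and>
                 (\<forall>\<^sub>F \<epsilon> in at_right 0. expansion_error p \<alpha> \<beta> a \<phi> x \<epsilon> + r \<epsilon> \<le> 0)))"
      using min_iff[OF \<open>x \<in> \<Omega>\<close>] by (intro iff_allI) blast
    finally show "(\<forall>\<phi>. C2_on \<Omega> \<phi> \<and> strict_min_at \<Omega> (\<lambda>y. u y - \<phi> y) x \<and> grad \<phi> x \<noteq> 0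
           \<longrightarrow> weighted_p_operator p a \<phi> x \<ge> 0) \<longleftrightarrow> \<dots>" .
    have "(\<forall>\<phi>. C2_on \<Omega> \<phi> \<and> strict_max_at \<Omega> (\<lambda>y. u y - \<phi> y) x \<and> grad \<phi> x \<noteq> 0
           \<longrightarrow> weighted_p_operator p a \<phi> x \<le> 0) \<longleftrightarrow>
        (\<forall>\<phi>. (C2_on \<Omega> \<phi> \<and> strict_max_at \<Omega> (\<lambda>y. u y - \<phi> y) x \<and> grad \<phi> x \<noteq> 0) \<and> u x = \<phi> x
           \<longrightarrow> weighted_p_operator p a \<phi> x \<le> 0)"
      by (rule normalize) (simp_all add: T T_strict)
    also have "\<dots> \<longleftrightarrow> (\<forall>\<phi>. C2_on \<Omega> \<phi> \<and> strict_max_at \<Omega> (\<lambda>y. u y - \<phi> y) x \<and> u x = \<phi> x \<and> grad \<phi> x \<noteq> 0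
           \<longrightarrow> (\<exists>r. ((\<lambda>\<epsilon>. r \<epsilon> / \<epsilon>\<^sup>2) \<longlongrightarrow> 0) (at_right 0) \<and>
                 (\<forall>\<^sub>F \<epsilon> in at_right 0. expansion_error p \<alpha> \<beta> a \<phi> x \<epsilon> + r \<epsilon> \<ge> 0)))"
      using max_iff[OF \<open>x \<in> \<Omega>\<close>] by (intro iff_allI) blast
    finally show "(\<forall>\<phi>. C2_on \<Omega> \<phi> \<and> strict_max_at \<Omega> (\<lambda>y. u y - \<phi> y) x \<and> grad \<phi> x \<noteq> 0
           \<longrightarrow> weighted_p_operator p a \<phi> x \<le> 0) \<longleftrightarrow> \<dots>" .
  qed
qed

end
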